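(* Let $T$ be a tree of order $n\geq 2$. Then the eigenvalues of the eccentricity matrix $\mathcal{E}(T)$ are symmetric about the origin (i.e., for every real $\lambda$, $\lambda$ and $-\lambda$ have the same multiplicity as eigenvalues of $\mathcal{E}(T)$) if and only if $T$ has odd diameter.
   Context: For a connected graph $G$ with distance function $d(u,v)$, the eccentricity of a vertex $u$ is $e(u)=\max_{v}d(u,v)$. The eccentricity matrix $\mathcal{E}(G)$ is the matrix indexed by $V(G)$ with $\mathcal{E}(G)_{uv}=d(u,v)$ if $d(u,v)=\min\{e(u),e(v)\}$, and $\mathcal{E}(G)_{uv}=0$ otherwise. The diameter is the largest distance between two vertices. *)

theory Defs
  imports "Jordan_Normal_Form.Char_Poly" "Graph_Theory.Graph_Theory"
begin

text \<open>
  A finite simple undirected graph is a \<^locale>\<open>graph\<close>: a finite, symmetric,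
  loop-free digraph without parallel arcs, an edge being a pair of opposite arcs.
\<close>

context pre_digraph
begin

text \<open>
  \<open>LEAST\<close> is meaningful when \<open>v\<close> is reachable from \<open>u\<close>, hence for all vertices of a
  connected graph; lemma \<open>mu_unit_eq_gdist\<close> relates this to the library's
  weighted distance.
\<close>

definition gdist :: "'a \<Rightarrow> 'a \<Rightarrow> nat" where
  "gdist u v = (LEAST k. \<exists>p. awalk u p v \<and> length p = k)"

definition eccentricity :: "'a \<Rightarrow> nat" where
  "eccentricity u = Max ((\<lambda>v. gdist u v) ` verts G)"

definition diameter :: nat where
  "diameter = Max ((\<lambda>(u, v). gdist u v) ` (verts G \<times> verts G))"

definition ecc_entry :: "'a \<Rightarrow> 'a \<Rightarrow> real" where
  "ecc_entry u v =
     (if gdist u v = min (eccentricity u) (eccentricity v) then real (gdist u v) else 0)"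

text \<open>
  The matrices of the library are indexed by an initial segment of the naturals, so the
  vertices are enumerated by a list \<open>vs\<close>, meant to contain each vertex exactly once.
\<close>

definition ecc_matrix :: "'a list \<Rightarrow> real mat" where
  "ecc_matrix vs = mat (length vs) (length vs) (\<lambda>(i, j). ecc_entry (vs ! i) (vs ! j))"

end

text \<open>
  The library's \<^const>\<open>tree\<close> excludes all directed cycles; in a symmetric digraph
  traversing an edge back and forth is a directed cycle of length 2, so that notion would
  only leave the one-vertex graph. The cycles of an undirected simple graph are those of
  length at least 3.
\<close>

locale undirected_tree = graph G for G :: "('a, 'b) pre_digraph" (structure) +
  assumes connected_G: "Digraph_Component.connected G"
    and no_cycle: "\<not> (\<exists>p. cycle p \<and> 3 \<le> length p)"

lemma (in wf_digraph) mu_unit_eq_gdist: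
  assumes "u \<rightarrow>\<^sup>* v"
  shows "\<mu> (\<lambda>_. 1) u v = ereal (real (gdist u v))"
proof -
  have cost: "awalk_cost (\<lambda>_. 1) p = real (length p)" for p
    by (induction p) auto
  obtain q where "awalk u q v" using assms by (auto simp: reachable_awalk)
  then have ex: "\<exists>k p. awalk u p v \<and> length p = k" by blast
  have "\<exists>p. awalk u p v \<and> length p = gdist u v"
    unfolding gdist_def by (rule LeastI_ex[OF ex])
  then obtain p where p: "awalk u p v" "length p = gdist u v" by blast
  have le: "gdist u v \<le> length r" if "awalk u r v" for r
    unfolding gdist_def using that by (blast intro: Least_le)
  show ?thesis
    unfolding \<mu>_def cost
  proof (rule antisym)
    show "(INF p\<in>{p. awalk u p v}. ereal (real (length p))) \<le> ereal (real (gdist u v))"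
      using p by (intro INF_lower2[of p]) auto
    show "ereal (real (gdist u v)) \<le> (INF p\<in>{p. awalk u p v}. ereal (real (length p)))"
      using le by (intro INF_greatest) auto
  qed
qed

end

theory Submission
  imports Defs "Jordan_Normal_Form.Schur_Decomposition"
begin

text \<open>
  The eccentricity matrix \<open>E\<close> is the weighted adjacency matrix of a graph with positive weights,
  and the question is whether that graph contains a triangle. Let \<open>u\<close>, \<open>v\<close> be two
  vertices at distance \<open>D\<close>, the diameter. Projecting vertices to the path from \<open>u\<close> to
  \<open>v\<close> gives one instance of the four-point condition, from which every eccentricity is attained
  at \<open>u\<close> or \<open>v\<close>. If \<open>D\<close> is odd, then no vertex is equally far from \<open>u\<close> and
  \<open>v\<close>, and the entries between vertices that are closer to the same end vanish; hence \<open>E\<close>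
  is conjugate to \<open>-E\<close> by a diagonal matrix of signs. If \<open>D\<close> is even, then \<open>u\<close>,
  \<open>v\<close> and the midpoint of their path form a triangle, so \<open>E\<^sup>3\<close> has positive trace,
  whereas the trace of the cube vanishes if the (real) spectrum is symmetric.
\<close>

subsection \<open>Real symmetric matrices\<close>

text \<open>Once a characteristic polynomial is split, multiplicities become counts in a list, and
  negating the spectrum becomes \<open>map uminus\<close>.\<close>

lemma order_prod_list_linear:
  fixes es :: "'a :: field list"
  shows "Polynomial.order x (\<Prod>e\<leftarrow>es. [:- e, 1:]) = count_list es x"
proof (induction es)
  case (Cons e es)
  have "(\<Prod>e\<leftarrow>es. [:- e, 1:]) \<noteq> 0" by (auto simp: prod_list_zero_iff)
  then have "[:- e, 1:] * (\<Prod>e\<leftarrow>es. [:- e, 1:]) \<noteq> 0"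
    by (simp del: mult_pCons_left)
  from order_mult[OF this, of x] Cons order_linear_power[of x "- e" 1] show ?case
    by (auto simp del: mult_pCons_left)
qed simp

text \<open>For an eigenvector \<open>v\<close>, the Hermitian form of \<open>A\<close> at
  \<open>v\<close> equals \<open>k\<close> times the squared norm of \<open>v\<close>. Symmetry of
  the real matrix makes the form invariant under conjugation, so \<open>k\<close> is too.\<close>

lemma symmetric_mat_eigenvalue_real:
  fixes A :: "real mat"
  assumes A: "A \<in> carrier_mat n n" and sym: "\<And>i j. i < n \<Longrightarrow> j < n \<Longrightarrow> A $$ (i, j) = A $$ (j, i)"
    and ev: "eigenvalue (map_mat complex_of_real A) k"
  shows "k \<in> \<real>"
proof -
  obtain v where v: "v \<in> carrier_vec n" "v \<noteq> 0\<^sub>v n"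
    "map_mat complex_of_real A *\<^sub>v v = k \<cdot>\<^sub>v v"
    using ev A unfolding eigenvalue_def eigenvector_def by auto
  have row: "(\<Sum>j<n. of_real (A $$ (i, j)) * v $ j) = k * v $ i" if "i < n" for i
    using arg_cong[OF v(3), of "\<lambda>w. w $ i"] that A v(1)
    by (auto simp: scalar_prod_def atLeast0LessThan)
  \<comment> \<open>\<open>?S\<close> is the squared norm of \<open>v\<close>, and \<open>?Q\<close>
    is the Hermitian form.\<close>
  let ?S = "\<Sum>i<n. cnj (v $ i) * v $ i"
  let ?Q = "\<Sum>i<n. \<Sum>j<n. cnj (v $ i) * (of_real (A $$ (i, j)) * v $ j)"
  have Q: "?Q = k * ?S"
    by (simp add: sum_distrib_left[symmetric] row) (simp add: sum_distrib_left mult_ac)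
  have "cnj ?Q = (\<Sum>i<n. \<Sum>j<n. cnj (v $ j) * (of_real (A $$ (j, i)) * v $ i))"
    using sym by (auto simp: mult_ac intro!: sum.cong)
  also have "\<dots> = ?Q" by (rule sum.swap)
  finally have "cnj ?Q = ?Q" .
  moreover have "cnj ?S = ?S" by (simp add: mult_ac)
  ultimately have "cnj k * ?S = k * ?S" unfolding Q by (metis complex_cnj_mult)
  moreover have "?S \<noteq> 0"
  proof -
    obtain i where i: "i < n" "v $ i \<noteq> 0"
      using v(1,2) by (metis carrier_vecD eq_vecI index_zero_vec)
    have "0 < (\<Sum>i<n. (cmod (v $ i))\<^sup>2)"
      using i by (intro sum_pos2[of _ i]) auto
    moreover have "?S = of_real (\<Sum>i<n. (cmod (v $ i))\<^sup>2)"
      by (simp add: complex_norm_square[symmetric] mult.commute del: of_real_power)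
    ultimately show ?thesis by (metis less_irrefl of_real_eq_0_iff)
  qed
  ultimately show ?thesis by (simp add: complex_is_Real_iff complex_eq_iff)
qed

text \<open>The polynomial splits over the complex numbers with real roots only, and injectivity of
  the embedding of the reals brings the factorization back.\<close>

lemma symmetric_mat_char_poly_splits:
  fixes A :: "real mat"
  assumes A: "A \<in> carrier_mat n n" and sym: "\<And>i j. i < n \<Longrightarrow> j < n \<Longrightarrow> A $$ (i, j) = A $$ (j, i)"
  obtains es where "char_poly A = (\<Prod>e\<leftarrow>es. [:- e, 1:])"
proof -
  let ?C = "map_mat complex_of_real A"
  have C: "?C \<in> carrier_mat n n" using A by simp
  obtain zs where zs: "char_poly ?C = (\<Prod>z\<leftarrow>zs. [:- z, 1:])"
    using char_poly_factorized[OF C] by blast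
  have "z \<in> \<real>" if "z \<in> set zs" for z
  proof (rule symmetric_mat_eigenvalue_real[OF A sym])
    show "eigenvalue ?C z"
      unfolding eigenvalue_root_char_poly[OF C] zs using that
      by (induction zs) auto
  qed
  then have "map (complex_of_real \<circ> Re) zs = zs"
    by (intro map_idI) (auto simp: Reals_def)
  then have zs': "zs = map complex_of_real (map Re zs)" by simp
  interpret map_poly_inj_idom_hom complex_of_real ..
  have "map_poly complex_of_real (char_poly A) = char_poly ?C"
    by (rule of_real_hom.char_poly_hom[OF A, symmetric])
  also have "\<dots> = (\<Prod>z\<leftarrow>map complex_of_real (map Re zs). [:- z, 1:])"
    using zs zs' by metis
  also have "\<dots> = map_poly complex_of_real (\<Prod>e\<leftarrow>map Re zs. [:- e, 1:])"
    by (simp add: hom_prod_list o_def)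
  finally have "char_poly A = (\<Prod>e\<leftarrow>map Re zs. [:- e, 1:])" by simp
  with that show thesis .
qed

text \<open>Schur triangularization serves in place of diagonalization: the diagonal of
  \<open>B\<close> already lists the eigenvalues with their multiplicities.\<close>

lemma symmetric_mat_triangular_form:
  fixes A :: "real mat"
  assumes A: "A \<in> carrier_mat n n" and sym: "\<And>i j. i < n \<Longrightarrow> j < n \<Longrightarrow> A $$ (i, j) = A $$ (j, i)"
  obtains B where "B \<in> carrier_mat n n" "upper_triangular B" "similar_mat A B"
    "char_poly A = (\<Prod>e\<leftarrow>diag_mat B. [:- e, 1:])"
proof -
  obtain es where "char_poly A = (\<Prod>e\<leftarrow>es. [:- e, 1:])"
    using symmetric_mat_char_poly_splits[OF A sym] by blast
  from schur_decomposition_exists[OF A this] obtain B where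
    B: "B \<in> carrier_mat n n" "upper_triangular B" "similar_mat A B" by blast
  with that char_poly_similar[OF B(3)] char_poly_upper_triangular[OF B(1,2)] show thesis by metis
qed

text \<open>All nonzero entries join the two classes of \<open>f\<close>, so changing the sign of
  one class of basis vectors turns \<open>A\<close> into \<open>- A\<close>.\<close>

lemma signed_symmetric_mat_spectrum:
  fixes A :: "real mat"
  assumes A: "A \<in> carrier_mat n n" and sym: "\<And>i j. i < n \<Longrightarrow> j < n \<Longrightarrow> A $$ (i, j) = A $$ (j, i)"
    and part: "\<And>i j. i < n \<Longrightarrow> j < n \<Longrightarrow> f i = (f j :: bool) \<Longrightarrow> A $$ (i, j) = 0"
  shows "Polynomial.order x (char_poly A) = Polynomial.order (- x) (char_poly A)"
proof -
  define D :: "real mat" where "D = mat_diag n (\<lambda>i. if f i then 1 else - 1)"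
  have D: "D \<in> carrier_mat n n" by (simp add: D_def)
  have DD: "D * D = 1\<^sub>m n"
    unfolding D_def mat_diag_diag by (rule eq_matI) (auto simp: mat_diag_def)
  \<comment> \<open>Entry \<open>(i, j)\<close> is multiplied by the signs of \<open>i\<close> and
    \<open>j\<close>. Their product is -1 between the classes, and inside a class the entry is
    0.\<close>
  have "D * A * D = - A"
    using A part by (intro eq_matI)
      (auto simp: D_def mat_diag_mult_left[of _ n n] mat_diag_mult_right[of _ n n])
  with A D DD have 1: "similar_mat (- A) A"
    by (intro similar_matI[of _ _ D D n]) auto
  obtain B where B: "B \<in> carrier_mat n n" "upper_triangular B" "similar_mat A B"
    and cp: "char_poly A = (\<Prod>e\<leftarrow>diag_mat B. [:- e, 1:])"
    using symmetric_mat_triangular_form[OF A sym] by blast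
  \<comment> \<open>The matrices that conjugate \<open>A\<close> to \<open>B\<close> also conjugate
    \<open>- A\<close> to \<open>- B\<close>, so the spectrum of \<open>- A\<close> is the negated
    diagonal of \<open>B\<close>.\<close>
  from similar_matD[OF B(3)] obtain m P Q where
    PQ: "{A, B, P, Q} \<subseteq> carrier_mat m m" "P * Q = 1\<^sub>m m" "Q * P = 1\<^sub>m m" "A = P * B * Q"
    by blast
  have "dim_col P = dim_row B" "dim_col (P * B) = dim_row Q" using PQ(1) by auto
  then have "- A = P * (- B) * Q" using PQ(4) by simp
  with PQ have 2: "similar_mat (- A) (- B)"
    by (intro similar_matI[of _ _ P Q m]) auto
  have "upper_triangular (- B)" using B(1,2)
    by (auto intro!: upper_triangularI dest: upper_triangularD)
  have diag: "diag_mat (- B) = map uminus (diag_mat B)"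
    using B(1) by (auto simp: diag_mat_def)
  have "char_poly A = char_poly (- B)"
    using char_poly_similar[OF 1] char_poly_similar[OF 2] by simp
  also have "\<dots> = (\<Prod>e\<leftarrow>map uminus (diag_mat B). [:- e, 1:])"
    unfolding diag[symmetric] using B(1) \<open>upper_triangular (- B)\<close>
    by (intro char_poly_upper_triangular[of _ n]) auto
  finally have "Polynomial.order (- x) (char_poly A) = count_list (map uminus (diag_mat B)) (- x)"
    by (simp only: order_prod_list_linear)
  also have "\<dots> = count_list (diag_mat B) x"
    by (simp add: inj_def count_list_map_conv)
  finally show ?thesis by (simp only: cp order_prod_list_linear)
qed

section \<open>Traces of matrix cubes\<close>

definition trace_mat :: "'a :: comm_ring_1 mat \<Rightarrow> 'a" where
  "trace_mat A = (\<Sum>i<dim_row A. A $$ (i, i))"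

lemma index_mult_mat_sum:
  assumes "A \<in> carrier_mat nr n" "B \<in> carrier_mat n nc" "i < nr" "j < nc"
  shows "(A * B) $$ (i, j) = (\<Sum>k<n. A $$ (i, k) * B $$ (k, j))"
  using assms by (auto simp: scalar_prod_def atLeast0LessThan)

lemma trace_mat_mult_commute:
  assumes "A \<in> carrier_mat n m" "B \<in> carrier_mat m n"
  shows "trace_mat (A * B) = trace_mat (B * A)"
proof -
  have "trace_mat (A * B) = (\<Sum>i<n. \<Sum>j<m. A $$ (i, j) * B $$ (j, i))"
    using assms by (auto simp: trace_mat_def scalar_prod_def atLeast0LessThan intro!: sum.cong)
  also have "\<dots> = (\<Sum>j<m. \<Sum>i<n. A $$ (i, j) * B $$ (j, i))" by (rule sum.swap)
  also have "\<dots> = trace_mat (B * A)"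
    using assms by (auto simp: trace_mat_def scalar_prod_def atLeast0LessThan mult.commute
        intro!: sum.cong)
  finally show ?thesis .
qed

lemma trace_mat_cube_similar:
  assumes "similar_mat A B"
  shows "trace_mat (A * A * A) = trace_mat (B * B * B)"
proof -
  from similar_matD[OF assms] obtain n P Q where
    c: "A \<in> carrier_mat n n" "B \<in> carrier_mat n n" "P \<in> carrier_mat n n" "Q \<in> carrier_mat n n"
    and PQ: "Q * P = 1\<^sub>m n" "A = P * B * Q" by auto
  \<comment> \<open>The inner factor \<open>Q * P\<close> cancels, so the threefold product
    telescopes; cyclicity of the trace then removes the outer \<open>P\<close> and
    \<open>Q\<close>.\<close>
  have step: "X * Q * (P * B * Q) = X * B * Q" if X: "X \<in> carrier_mat n n" for X
  proof -
    have "X * Q * (P * B * Q) = X * ((Q * P) * (B * Q))"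
      using c X by (simp add: assoc_mult_mat[of _ n n _ n _ n])
    also have "\<dots> = X * B * Q" using c X PQ by (simp add: assoc_mult_mat[of _ n n _ n _ n])
    finally show ?thesis .
  qed
  have "A * A * A = P * (B * B * B) * Q"
    unfolding PQ(2) using c step[of "P * B"] step[of "P * B * B"]
    by (simp add: assoc_mult_mat[of _ n n _ n _ n])
  then have "trace_mat (A * A * A) = trace_mat (P * (B * B * B * Q))"
    using c by (simp add: assoc_mult_mat[of _ n n _ n _ n])
  also have "\<dots> = trace_mat (B * B * B * Q * P)"
    using c by (intro trace_mat_mult_commute[of _ n n]) auto
  also have "B * B * B * Q * P = B * B * B"
    using c PQ(1) by (simp add: assoc_mult_mat[of _ n n _ n _ n])
  finally show ?thesis .
qed

lemma upper_triangular_mult: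
  fixes A B :: "'a :: comm_ring_1 mat"
  assumes A: "A \<in> carrier_mat n n" "upper_triangular A"
    and B: "B \<in> carrier_mat n n" "upper_triangular B"
  shows "upper_triangular (A * B)" "\<And>i. i < n \<Longrightarrow> (A * B) $$ (i, i) = A $$ (i, i) * B $$ (i, i)"
proof -
  have entry: "(A * B) $$ (i, j) = (\<Sum>k<n. A $$ (i, k) * B $$ (k, j))" if "i < n" "j < n" for i j
    using A(1) B(1) that by (rule index_mult_mat_sum)
  \<comment> \<open>One factor lies below the diagonal. For \<open>j < i\<close> this covers every
    \<open>k\<close>, and for \<open>j = i\<close> every \<open>k\<close> except
    \<open>i\<close>.\<close>
  have zero: "A $$ (i, k) * B $$ (k, j) = 0" if "i < n" "k < n" "k < i \<or> j < k" for i j k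
    using that A B by (auto dest: upper_triangularD)
  show "upper_triangular (A * B)"
  proof (rule upper_triangularI)
    fix i j assume ij: "j < i" "i < dim_row (A * B)"
    then have "i < n" "j < n" using A by auto
    then show "(A * B) $$ (i, j) = 0"
      using ij zero[of i _ j] by (subst entry) (auto intro!: sum.neutral, meson leI le_less_trans)
  qed
  fix i assume i: "i < n"
  have "(A * B) $$ (i, i) = (\<Sum>k\<in>{i}. A $$ (i, k) * B $$ (k, i))"
    unfolding entry[OF i i] using i zero[OF i, of _ i]
    by (intro sum.mono_neutral_right) (auto simp: nat_neq_iff)
  then show "(A * B) $$ (i, i) = A $$ (i, i) * B $$ (i, i)" by simp
qed

text \<open>The trace of the cube is the sum of the cubes of the eigenvalues. Cubing is odd, so a
  multiset of eigenvalues invariant under negation gives 0.\<close>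

lemma symmetric_spectrum_trace_cube:
  fixes A :: "real mat"
  assumes A: "A \<in> carrier_mat n n" and sym: "\<And>i j. i < n \<Longrightarrow> j < n \<Longrightarrow> A $$ (i, j) = A $$ (j, i)"
    and spec: "\<And>x. Polynomial.order x (char_poly A) = Polynomial.order (- x) (char_poly A)"
  shows "trace_mat (A * A * A) = 0"
proof -
  obtain B where B: "B \<in> carrier_mat n n" "upper_triangular B" "similar_mat A B"
    and cp: "char_poly A = (\<Prod>e\<leftarrow>diag_mat B. [:- e, 1:])"
    using symmetric_mat_triangular_form[OF A sym] by blast
  let ?es = "diag_mat B"
  have "mset ?es = mset (map uminus ?es)"
  proof (rule multiset_eqI)
    fix x
    have "count_list ?es x = count_list ?es (- x)"
      using spec[of x] by (simp only: cp order_prod_list_linear)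
    also have "\<dots> = count_list (map uminus ?es) (- (- x))"
      by (rule count_list_map_conv[symmetric]) (simp add: inj_def)
    finally show "count (mset ?es) x = count (mset (map uminus ?es)) x"
      by (simp only: count_mset minus_minus)
  qed
  then have "mset (map (\<lambda>e. e ^ 3) ?es) = mset (map (\<lambda>e. e ^ 3) (map uminus ?es))"
    by (simp only: mset_map)
  then have "(\<Sum>e\<leftarrow>?es. e ^ 3) = (\<Sum>e\<leftarrow>map uminus ?es. e ^ 3)"
    by (metis sum_mset_sum_list)
  also have "\<dots> = - (\<Sum>e\<leftarrow>?es. e ^ 3)"
    by (simp add: o_def uminus_sum_list_map)
  finally have "(\<Sum>e\<leftarrow>?es. e ^ 3) = 0" by simp
  moreover have "trace_mat (B * B * B) = (\<Sum>e\<leftarrow>?es. e ^ 3)"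
  proof -
    note BB = upper_triangular_mult[OF B(1,2) B(1,2)]
    have "(B * B * B) $$ (i, i) = B $$ (i, i) ^ 3" if "i < n" for i
      using upper_triangular_mult(2)[OF _ BB(1) B(1,2)] BB(2)[OF that] B(1) that
      by (simp add: power3_eq_cube)
    then show ?thesis using B(1)
      by (simp add: trace_mat_def diag_mat_def o_def interv_sum_list_conv_sum_set_nat
          atLeast0LessThan)
  qed
  ultimately show ?thesis using trace_mat_cube_similar[OF B(3)] by simp
qed

text \<open>The trace of the cube sums the weights of closed walks of length 3. Without negative
  weights nothing cancels the walk through \<open>i\<close>, \<open>j\<close>,
  \<open>k\<close>.\<close>

lemma trace_cube_pos:
  fixes A :: "real mat"
  assumes A: "A \<in> carrier_mat n n" and nonneg: "\<And>i j. i < n \<Longrightarrow> j < n \<Longrightarrow> 0 \<le> A $$ (i, j)"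
    and tri: "i < n" "j < n" "k < n" "0 < A $$ (i, j)" "0 < A $$ (j, k)" "0 < A $$ (k, i)"
  shows "0 < trace_mat (A * A * A)"
proof -
  have AA: "(A * A) $$ (a, c) = (\<Sum>b<n. A $$ (a, b) * A $$ (b, c))" if "a < n" "c < n" for a c
    using A A that by (rule index_mult_mat_sum)
  have AAA: "(A * A * A) $$ (a, a) = (\<Sum>c<n. (A * A) $$ (a, c) * A $$ (c, a))" if "a < n" for a
    using A that by (intro index_mult_mat_sum[where nc = n]) auto
  have nn: "0 \<le> (A * A) $$ (a, c)" if "a < n" "c < n" for a c
    using that nonneg by (auto simp: AA intro!: sum_nonneg)
  have "0 < (A * A) $$ (i, k)"
    unfolding AA[OF tri(1,3)] using tri nonneg by (intro sum_pos2[of _ j]) auto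
  then have "0 < (A * A * A) $$ (i, i)"
    unfolding AAA[OF tri(1)] using tri nonneg nn by (intro sum_pos2[of _ k]) auto
  moreover have "0 \<le> (A * A * A) $$ (a, a)" if "a < n" for a
    unfolding AAA[OF that] using that nonneg nn by (auto intro!: sum_nonneg)
  ultimately show ?thesis
    using A tri(1) by (auto simp: trace_mat_def intro!: sum_pos2[of _ i])
qed

subsection \<open>Distances in trees\<close>

text \<open>Each arc is replaced by an opposite arc. The vertex list is tracked because distinctness
  and disjointness of paths are read off from it.\<close>

lemma (in sym_digraph) awalk_reverse:
  assumes "awalk u p v"
  shows "\<exists>q. awalk v q u \<and> awalk_verts v q = rev (awalk_verts u p)"
  using assms
proof (induction p arbitrary: u)
  case Nil
  then show ?case by (intro exI[of _ "[]"]) (auto simp: awalk_Nil_iff)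
next
  case (Cons e es)
  then have e: "e \<in> arcs G" "u = tail G e" and es: "awalk (head G e) es v"
    by (auto simp: awalk_Cons_iff)
  from Cons.IH[OF es] obtain q where
    q: "awalk v q (head G e)" "awalk_verts v q = rev (awalk_verts (head G e) es)" by blast
  obtain e' where e': "e' \<in> arcs G" "tail G e' = head G e" "head G e' = tail G e"
    using sym_arcs e(1) unfolding symmetric_conv by metis
  have w: "awalk v (q @ [e']) u"
    using q(1) e e' by (intro awalk_appendI[OF q(1)]) (auto simp: awalk_simps)
  have "awalk_verts v (q @ [e']) = rev (awalk_verts u (e # es))"
    by (subst awalk_verts_append[OF w]) (simp add: q e e')
  with w show ?case by blast
qed

lemma (in sym_digraph) apath_reverse:
  assumes "apath u p v"
  shows "\<exists>q. apath v q u \<and> awalk_verts v q = rev (awalk_verts u p) \<and> length q = length p"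
proof -
  obtain q where q: "awalk v q u" "awalk_verts v q = rev (awalk_verts u p)"
    using assms awalk_reverse[of u p v] by (auto simp: apath_def)
  from arg_cong[OF q(2), of length] have "length q = length p"
    by (simp add: length_awalk_verts)
  with q assms show ?thesis by (auto simp: apath_def)
qed

lemma (in wf_digraph) apath_split:
  assumes "apath u p v" "w \<in> set (awalk_verts u p)"
  obtains q r where "p = q @ r" "apath u q w" "apath w r v"
proof -
  obtain q r where qr: "p = q @ r" "awalk u q w" "awalk w r v"
    using assms awalk_decomp[of u p v w] by (auto simp: apath_def)
  then have "awlast u q = w" by auto
  with assms(1) qr that show thesis by (auto simp: apath_append_iff)
qed

lemma (in wf_digraph) set_tl_awalk_verts:
  assumes "apath u p v"
  shows "set (tl (awalk_verts u p)) = set (awalk_verts u p) - {u}"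
  using assms by (cases p) (auto simp: apath_def awalk_simps)

lemma (in wf_digraph) apath_appendI:
  assumes "apath u p v" "apath v q w"
    and "set (awalk_verts u p) \<inter> set (awalk_verts v q) = {v}"
  shows "apath u (p @ q) w"
proof -
  have last: "awlast u p = v" using assms(1) by (auto simp: apath_def)
  have "set (awalk_verts u p) \<inter> set (tl (awalk_verts v q)) = {}"
    using assms(3) by (auto simp: set_tl_awalk_verts[OF assms(2)])
  with assms last show ?thesis by (auto simp: apath_append_iff)
qed

lemma (in pre_digraph) gdist_le_awalk:
  assumes "awalk u p v" shows "gdist u v \<le> length p"
  unfolding gdist_def using assms by (blast intro: Least_le)

text \<open>Cutting closed detours out of a walk never lengthens it, so shortest walks may be
  replaced by paths.\<close>

lemma (in wf_digraph) length_awalk_to_apath: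
  assumes "awalk u p v" shows "length (awalk_to_apath p) \<le> length p"
  using assms
proof (induct rule: awalk_to_apath_induct)
  case (path p)
  then show ?case by (subst awalk_to_apath.simps) auto
next
  case (decomp p q r s)
  then show ?case
    using step_awalk_to_apath[OF decomp(1-3)] awalk_cyc_decompE[OF decomp(2,1,3)] by force
qed

lemma (in pre_digraph) ecc_entry_nonneg: "0 \<le> ecc_entry x y"
  by (simp add: ecc_entry_def)

context undirected_tree
begin

section \<open>Unique paths and the tree metric\<close>

text \<open>Going along \<open>p\<close> and back along the reverse of \<open>q\<close> is a cycle.
  Only length 2 is possible, so both paths are single arcs, and these coincide because there are no
  parallel arcs.\<close>

lemma internally_disjoint_apaths_eq:
  assumes p: "apath u p v" and q: "apath u q v"
    and disj: "set (awalk_verts u p) \<inter> set (awalk_verts u q) \<subseteq> {u, v}"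
  shows "p = q"
proof (cases "u = v")
  case True
  then show ?thesis using p q by (metis apath_nonempty_ends)
next
  case False
  then have ne: "p \<noteq> []" "q \<noteq> []" using p q by (auto simp: apath_Nil_iff)
  obtain q' where q': "apath v q' u" "awalk_verts v q' = rev (awalk_verts u q)"
    "length q' = length q"
    using apath_reverse[OF q] by blast
  have walk: "awalk u (p @ q') u"
    using p q' by (intro awalk_appendI[of u p v]) (auto simp: apath_def)
  have "tl (awalk_verts u (p @ q')) = tl (awalk_verts u p) @ tl (awalk_verts v q')"
    using walk p by (subst awalk_verts_append[OF walk]) (auto simp: apath_def)
  moreover have "distinct (tl (awalk_verts u p))" "distinct (tl (awalk_verts v q'))"
    using p q'(1) by (auto simp: apath_def intro: distinct_tl)
  \<comment> \<open>Dropping the first vertices removes \<open>u\<close> from one list and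
    \<open>v\<close> from the other, so neither shared end remains in both.\<close>
  moreover have "set (tl (awalk_verts u p)) \<inter> set (tl (awalk_verts v q')) = {}"
    using disj unfolding set_tl_awalk_verts[OF p] set_tl_awalk_verts[OF q'(1)]
    by (auto simp: q'(2))
  ultimately have "distinct (tl (awalk_verts u (p @ q')))" by simp
  with walk ne have "cycle (p @ q')" by (auto simp: cycle_def)
  with no_cycle q'(3) have "length p + length q < 3" by force
  with ne obtain a b where ab: "p = [a]" "q = [b]"
    by (cases p; cases q) (auto simp: Suc_less_eq2 less_Suc_eq)
  with p q show ?thesis
    using no_multi_arcs[of a b] by (auto simp: apath_simps arc_to_ends_def)
qed

text \<open>Two paths sharing a further vertex \<open>w\<close> are split there, and both pairs of
  pieces are shorter in total; otherwise the paths are internally disjoint.\<close>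

lemma unique_apath:
  assumes "apath u p v" "apath u q v"
  shows "p = q"
  using assms
proof (induction "length p + length q" arbitrary: u v p q rule: less_induct)
  case less
  show ?case
  proof (cases "set (awalk_verts u p) \<inter> set (awalk_verts u q) \<subseteq> {u, v}")
    case True
    then show ?thesis using less.prems by (rule internally_disjoint_apaths_eq[rotated 2])
  next
    case False
    then obtain w where w: "w \<in> set (awalk_verts u p)" "w \<in> set (awalk_verts u q)"
      "w \<noteq> u" "w \<noteq> v" by blast
    obtain p1 p2 where p: "p = p1 @ p2" "apath u p1 w" "apath w p2 v"
      using apath_split[OF less.prems(1) w(1)] by blast
    obtain q1 q2 where q: "q = q1 @ q2" "apath u q1 w" "apath w q2 v"
      using apath_split[OF less.prems(2) w(2)] by blast
    have "p1 \<noteq> []" "p2 \<noteq> []" using p w by (auto simp: apath_Nil_iff)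
    then have "length p1 + length q1 < length p + length q"
      "length p2 + length q2 < length p + length q" using p q by auto
    then have "p1 = q1" "p2 = q2"
      using less.hyps p(2,3) q(2,3) by blast+
    with p q show ?thesis by simp
  qed
qed

lemma apath_exists:
  assumes "u \<in> verts G" "v \<in> verts G"
  obtains p where "apath u p v"
proof -
  have "u \<rightarrow>\<^sup>*\<^bsub>mk_symmetric G\<^esub> v"
    using connected_G assms unfolding connected_def strongly_connected_def by auto
  then have "u \<rightarrow>\<^sup>* v" using reachable_mk_symmetric_eq[OF sym_arcs] by simp
  with that show thesis by (auto simp: reachable_apath)
qed

text \<open>A shortest walk reduces to a path, which by uniqueness is \<open>p\<close>. Distances
  can thus be computed as lengths of any path at hand.\<close>

lemma gdist_eq_apath:
  assumes p: "apath u p v" shows "gdist u v = length p"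
proof (rule antisym)
  show "gdist u v \<le> length p" using p by (intro gdist_le_awalk) (simp add: apath_def)
  have "\<exists>k q. awalk u q v \<and> length q = k" using p by (auto simp: apath_def)
  from LeastI_ex[OF this] obtain q where q: "awalk u q v" "length q = gdist u v"
    by (auto simp: gdist_def)
  from apath_awalk_to_apath[OF q(1)] have "awalk_to_apath q = p"
    using p by (rule unique_apath)
  with length_awalk_to_apath[OF q(1)] q(2) show "length p \<le> gdist u v" by simp
qed

lemma gdist_commute:
  assumes "u \<in> verts G" "v \<in> verts G" shows "gdist u v = gdist v u"
proof -
  obtain p where p: "apath u p v" using apath_exists[OF assms] .
  with apath_reverse[OF p] gdist_eq_apath show ?thesis by metis
qed

lemma gdist_triangle:
  assumes "u \<in> verts G" "v \<in> verts G" "w \<in> verts G"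
  shows "gdist u w \<le> gdist u v + gdist v w"
proof -
  obtain p q where pq: "apath u p v" "apath v q w" using apath_exists assms by metis
  then have "awalk u (p @ q) w" by (auto simp: apath_def intro: awalk_appendI)
  from gdist_le_awalk[OF this] pq show ?thesis by (simp add: gdist_eq_apath)
qed

lemma gdist_self: "u \<in> verts G \<Longrightarrow> gdist u u = 0"
  using gdist_eq_apath[of u "[]" u] by (simp add: apath_Nil_iff)

section \<open>Projection to a path, parity and the four-point condition\<close>

text \<open>Let \<open>m\<close> be a vertex of the path nearest to \<open>z\<close>. The path from
  \<open>z\<close> to \<open>m\<close> meets \<open>p\<close> only at \<open>m\<close>, so it
  extends along \<open>p\<close> to a path towards either end.\<close>

lemma apath_projection:
  assumes p: "apath u p v" and z: "z \<in> verts G"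
  obtains q m r where "p = q @ r" "apath u q m" "apath m r v"
    "gdist z u = gdist z m + length q" "gdist z v = gdist z m + length r"
proof -
  let ?S = "set (awalk_verts u p)"
  define m where "m = arg_min_on (gdist z) ?S"
  have m: "m \<in> ?S" "\<And>w. w \<in> ?S \<Longrightarrow> gdist z m \<le> gdist z w"
    unfolding m_def by (auto intro: arg_min_if_finite arg_min_least)
  have S: "?S \<subseteq> verts G" using p by (auto simp: apath_def)
  obtain q r where qr: "p = q @ r" "apath u q m" "apath m r v"
    using apath_split[OF p m(1)] by blast
  have sub: "set (awalk_verts u q) \<subseteq> ?S" "set (awalk_verts m r) \<subseteq> ?S"
    using qr p set_awalk_verts_append[of u q m r v] by (auto simp: apath_def)
  obtain t where t: "apath z t m" using apath_exists m(1) S z by blast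
  have only_m: "w = m" if w: "w \<in> set (awalk_verts z t)" "w \<in> ?S" for w
  proof -
    obtain t1 t2 where t12: "t = t1 @ t2" "apath z t1 w" "apath w t2 m"
      using apath_split[OF t w(1)] by blast
    \<comment> \<open>\<open>t1\<close> measures the distance from \<open>z\<close> to
      \<open>w\<close>, so minimality of \<open>m\<close> forces \<open>t2\<close> to be
      empty.\<close>
    have "length t \<le> length t1" using m(2)[OF w(2)] t12 t gdist_eq_apath by metis
    with t12 show ?thesis by (auto simp: apath_Nil_iff)
  qed
  have m_in: "m \<in> set (awalk_verts z t)" using t by (auto simp: apath_def)
  have dist: "gdist z x = gdist z m + length s"
    if s: "apath m s x" "set (awalk_verts m s) \<subseteq> ?S" for s x
  proof -
    have "m \<in> set (awalk_verts m s)" using s(1) by (auto dest: hd_in_awalk_verts)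
    then have "set (awalk_verts z t) \<inter> set (awalk_verts m s) = {m}"
      using only_m m_in s(2) by blast
    from apath_appendI[OF t s(1) this] show ?thesis
      using t by (simp add: gdist_eq_apath)
  qed
  obtain q' where q': "apath m q' u" "awalk_verts m q' = rev (awalk_verts u q)"
    "length q' = length q" using apath_reverse[OF qr(2)] by blast
  have "gdist z u = gdist z m + length q"
    using dist[OF q'(1)] q' sub by simp
  moreover have "gdist z v = gdist z m + length r"
    using dist[OF qr(3)] sub by simp
  ultimately show thesis using that qr by blast
qed

text \<open>With \<open>m\<close> the projection of \<open>z\<close>, the sum is twice
  \<open>gdist z m\<close> plus twice the length of the path from \<open>u\<close> to
  \<open>v\<close>.\<close>

lemma gdist_parity:
  assumes "u \<in> verts G" "v \<in> verts G" "z \<in> verts G"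
  shows "even (gdist z u + gdist z v + gdist u v)"
proof -
  obtain p where p: "apath u p v" using apath_exists assms by blast
  from apath_projection[OF p assms(3)] gdist_eq_apath[OF p] show ?thesis
    by (smt (verit, best) add.assoc add.commute even_add length_append)
qed

text \<open>Project \<open>z\<close> and \<open>w\<close> to \<open>m\<close> and \<open>m'\<close>
  on the path from \<open>u\<close> to \<open>v\<close>. The route from \<open>z\<close> to
  \<open>w\<close> through \<open>m\<close> and \<open>m'\<close> bounds \<open>gdist z w\<close>,
  and the order of \<open>m\<close> and \<open>m'\<close> decides which term of the maximum is
  used.\<close>

lemma gdist_four_point:
  assumes "u \<in> verts G" "v \<in> verts G" "z \<in> verts G" "w \<in> verts G"
  shows "gdist z w + gdist u v \<le> max (gdist z u + gdist w v) (gdist z v + gdist w u)"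
proof -
  obtain p where p: "apath u p v" using apath_exists assms by blast
  note len = gdist_eq_apath[OF p]
  obtain q m r where 1: "p = q @ r" "apath u q m" "apath m r v"
    "gdist z u = gdist z m + length q" "gdist z v = gdist z m + length r"
    using apath_projection[OF p assms(3)] by blast
  obtain q' m' r' where 2: "p = q' @ r'" "apath u q' m'" "apath m' r' v"
    "gdist w u = gdist w m' + length q'" "gdist w v = gdist w m' + length r'"
    using apath_projection[OF p assms(4)] by blast
  have V: "m \<in> verts G" "m' \<in> verts G" using 1 2 by (auto simp: apath_def)
  have gap: "gdist a b \<le> length s"
    if "apath u x a" "apath u (x @ s) b" for x s a b
  proof -
    have "awlast u x = a" using that(1) by (auto simp: apath_def)
    with that(2) have "awalk a s b" by (auto simp: apath_def)
    then show ?thesis by (rule gdist_le_awalk)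
  qed
  have tri: "gdist z w \<le> gdist z m + (gdist m m' + gdist w m')"
    using gdist_triangle[of z m w] gdist_triangle[of m m' w] gdist_commute[of m' w] V assms
    by simp
  \<comment> \<open>Comparing the two splittings of \<open>p\<close> shows which projection comes
    first; \<open>s\<close> is the stretch between them.\<close>
  from 1(1) 2(1) have "q @ r = q' @ r'" by simp
  then consider s where "q' = q @ s" "r = s @ r'" | s where "q = q' @ s" "r' = s @ r"
    by (auto simp: append_eq_append_conv2)
  then show ?thesis
  proof cases
    case 1
    then show ?thesis using gap[of q m s m'] tri \<open>apath u q m\<close> \<open>apath u q' m'\<close> len
        \<open>p = q @ r\<close> \<open>gdist z u = _\<close> \<open>gdist z v = _\<close> \<open>gdist w u = _\<close> \<open>gdist w v = _\<close>
      by simp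
  next
    case 2
    then show ?thesis using gap[of q' m' s m] tri \<open>apath u q m\<close> \<open>apath u q' m'\<close> len
        \<open>p = q @ r\<close> \<open>gdist z u = _\<close> \<open>gdist z v = _\<close> \<open>gdist w u = _\<close> \<open>gdist w v = _\<close>
        gdist_commute[OF V]
      by simp
  qed
qed

section \<open>Diametral pairs and eccentricities\<close>

lemma diameter_attained:
  obtains u v where "u \<in> verts G" "v \<in> verts G" "gdist u v = diameter"
proof -
  have "verts G \<noteq> {}" using connected_G unfolding connected_def strongly_connected_def by auto
  then have "diameter \<in> (\<lambda>(u, v). gdist u v) ` (verts G \<times> verts G)"
    unfolding diameter_def by (intro Max_in) auto
  with that show thesis by auto
qed

lemma gdist_le_diameter:
  assumes "u \<in> verts G" "v \<in> verts G" shows "gdist u v \<le> diameter"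
  unfolding diameter_def using assms by (intro Max_ge) (auto intro: rev_image_eqI)

text \<open>In the four-point condition for \<open>z\<close> and any \<open>w\<close>, the distances
  from \<open>w\<close> to \<open>u\<close> and \<open>v\<close> are at most
  \<open>gdist u v\<close>, which cancels.\<close>

lemma eccentricity_diametral:
  assumes uv: "u \<in> verts G" "v \<in> verts G" "gdist u v = diameter" and z: "z \<in> verts G"
  shows "eccentricity z = max (gdist z u) (gdist z v)"
  unfolding eccentricity_def
proof (rule Max_eqI)
  show "finite (gdist z ` verts G)" by simp
  show "max (gdist z u) (gdist z v) \<in> gdist z ` verts G" using uv by (simp add: max_def)
  fix y assume "y \<in> gdist z ` verts G"
  then obtain w where w: "w \<in> verts G" "y = gdist z w" by blast
  show "y \<le> max (gdist z u) (gdist z v)"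
    using gdist_four_point[OF uv(1,2) z w(1)] gdist_le_diameter[OF w(1) uv(1)]
      gdist_le_diameter[OF w(1) uv(2)] uv(3) w(2) by simp
qed

lemma ecc_entry_commute:
  "x \<in> verts G \<Longrightarrow> y \<in> verts G \<Longrightarrow> ecc_entry x y = ecc_entry y x"
  by (simp add: ecc_entry_def gdist_commute min.commute)

text \<open>\<open>f\<close> records which end of a diametral pair is nearer; by parity there are no
  ties. Two vertices nearer to the same end are closer to each other than either
  eccentricity.\<close>

lemma odd_diameter_bipartite:
  assumes "odd diameter"
  obtains f :: "'a \<Rightarrow> bool" where
    "\<And>x y. x \<in> verts G \<Longrightarrow> y \<in> verts G \<Longrightarrow> f x = f y \<Longrightarrow> ecc_entry x y = 0"
proof -
  obtain u v where uv: "u \<in> verts G" "v \<in> verts G" "gdist u v = diameter"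
    using diameter_attained .
  \<comment> \<open>The ends are quantified afresh, so that the claim also applies with
    \<open>u\<close> and \<open>v\<close> exchanged.\<close>
  have close: "gdist x y < eccentricity x"
    if uv: "u \<in> verts G" "v \<in> verts G" "gdist u v = diameter"
      and xy: "x \<in> verts G" "y \<in> verts G"
      and less: "gdist x u < gdist x v" "gdist y u < gdist y v" for u v x y
    using gdist_four_point[OF uv(1,2) xy] eccentricity_diametral[OF uv xy(1)]
      gdist_le_diameter[OF xy(2) uv(2)] less uv(3) by simp
  have ne: "gdist x u \<noteq> gdist x v" if "x \<in> verts G" for x
    using gdist_parity[OF uv(1,2) that] assms uv(3) by auto
  have vu: "v \<in> verts G" "u \<in> verts G" "gdist v u = diameter"
    using uv gdist_commute by auto
  have "gdist x y < eccentricity x"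
    if "x \<in> verts G" "y \<in> verts G" "(gdist x u < gdist x v) = (gdist y u < gdist y v)" for x y
    using that close[OF uv that(1,2)] close[OF vu that(1,2)] ne[of x] ne[of y]
    by (meson linorder_neqE_nat)
  then have "ecc_entry x y = 0"
    if "x \<in> verts G" "y \<in> verts G" "(gdist x u < gdist x v) = (gdist y u < gdist y v)" for x y
    using that gdist_commute[of x y]
    by (smt (verit) ecc_entry_def less_irrefl min_def)
  then show thesis using that[of "\<lambda>x. gdist x u < gdist x v"] by blast
qed

text \<open>The midpoint \<open>c\<close> has half the diameter as its eccentricity and lies at
  exactly that distance from \<open>u\<close> and \<open>v\<close>, so all three entries are
  nonzero.\<close>

lemma even_diameter_triangle:
  assumes "even diameter" "2 \<le> card (verts G)"
  obtains u v c where "u \<in> verts G" "v \<in> verts G" "c \<in> verts G"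
    "0 < ecc_entry u v" "0 < ecc_entry v c" "0 < ecc_entry c u"
proof -
  obtain u v where uv: "u \<in> verts G" "v \<in> verts G" "gdist u v = diameter"
    using diameter_attained .
  obtain p where p: "apath u p v" using apath_exists uv by blast
  define k where "k = diameter div 2"
  have k: "diameter = 2 * k" using assms(1) by (simp add: k_def)
  have len: "length p = 2 * k" using gdist_eq_apath[OF p] uv k by simp
  define c where "c = awlast u (take k p)"
  have "apath u (take k p @ drop k p) v" using p by simp
  then have c: "apath u (take k p) c" "apath c (drop k p) v"
    unfolding c_def by (simp_all only: apath_append_iff)
  have cV: "c \<in> verts G" using c by (auto simp: apath_def)
  have d: "gdist u c = k" "gdist c v = k"
    using gdist_eq_apath[OF c(1)] gdist_eq_apath[OF c(2)] len by auto
  \<comment> \<open>Two distinct vertices exclude diameter 0, for which all three entries would be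
    0.\<close>
  have "k > 0"
  proof -
    obtain x y where xy: "x \<in> verts G" "y \<in> verts G" "x \<noteq> y"
      using assms(2) by (metis card_2_iff' finite_verts obtain_subset_with_card_n subsetD)
    obtain q where q: "apath x q y" using apath_exists xy by blast
    then have "q \<noteq> []" using xy by (auto simp: apath_Nil_iff)
    then show ?thesis
      using gdist_le_diameter[OF xy(1,2)] gdist_eq_apath[OF q] k by (cases q) auto
  qed
  moreover have "eccentricity u = 2 * k" "eccentricity v = 2 * k" "eccentricity c = k"
    using eccentricity_diametral[OF uv uv(1)] eccentricity_diametral[OF uv uv(2)]
      eccentricity_diametral[OF uv cV] gdist_self uv d k
      gdist_commute[OF uv(1,2)] gdist_commute[OF uv(1) cV]
    by auto
  ultimately show thesis
    using that[OF uv(1,2) cV] d uv k gdist_commute[OF uv(1) cV] gdist_commute[OF uv(2) cV]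
    by (simp add: ecc_entry_def)
qed

end

subsection \<open>Spectral symmetry\<close>

text \<open>The order of \<open>x\<close> as a root of the characteristic polynomial is its
  algebraic multiplicity, and 0 when \<open>x\<close> is no eigenvalue. For this symmetric matrix it
  agrees with the geometric multiplicity.\<close>

theorem theorem4p7:
  fixes G :: "('a, 'b) pre_digraph" and vs :: "'a list"
  assumes "undirected_tree G"
    and "card (verts G) \<ge> 2"
    and "distinct vs" and "set vs = verts G"
  shows "(\<forall>x::real. Polynomial.order x (char_poly (pre_digraph.ecc_matrix G vs))
                  = Polynomial.order (- x) (char_poly (pre_digraph.ecc_matrix G vs)))
     \<longleftrightarrow> odd (pre_digraph.diameter G)"
proof -
  interpret undirected_tree G by fact
  let ?n = "length vs" and ?A = "ecc_matrix vs"
  have A: "?A \<in> carrier_mat ?n ?n" by (simp add: ecc_matrix_def)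
  have entry: "?A $$ (i, j) = ecc_entry (vs ! i) (vs ! j)" if "i < ?n" "j < ?n" for i j
    using that by (simp add: ecc_matrix_def)
  have V: "vs ! i \<in> verts G" if "i < ?n" for i
    using that assms(4) nth_mem by blast
  have sym: "?A $$ (i, j) = ?A $$ (j, i)" if "i < ?n" "j < ?n" for i j
    using that V by (simp add: entry ecc_entry_commute)
  show ?thesis
  proof
    assume spec: "\<forall>x. Polynomial.order x (char_poly ?A) = Polynomial.order (- x) (char_poly ?A)"
    show "odd diameter"
    proof (rule ccontr)
      assume "\<not> odd diameter"
      then obtain u v c where tri: "u \<in> verts G" "v \<in> verts G" "c \<in> verts G"
        "0 < ecc_entry u v" "0 < ecc_entry v c" "0 < ecc_entry c u"
        using even_diameter_triangle assms(2) by blast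
      then obtain i j k where ijk: "i < ?n" "j < ?n" "k < ?n" "vs ! i = u" "vs ! j = v" "vs ! k = c"
        using assms(4) by (metis in_set_conv_nth)
      have "0 < trace_mat (?A * ?A * ?A)"
        using A ijk tri by (intro trace_cube_pos[of _ ?n i j k]) (simp_all add: entry ecc_entry_nonneg)
      moreover have "trace_mat (?A * ?A * ?A) = 0"
        using A sym spec by (intro symmetric_spectrum_trace_cube) auto
      ultimately show False by simp
    qed
  next
    assume "odd diameter"
    then obtain f :: "'a \<Rightarrow> bool" where
      f: "\<And>x y. x \<in> verts G \<Longrightarrow> y \<in> verts G \<Longrightarrow> f x = f y \<Longrightarrow> ecc_entry x y = 0"
      using odd_diameter_bipartite by blast
    show "\<forall>x. Polynomial.order x (char_poly ?A) = Polynomial.order (- x) (char_poly ?A)"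
      \<comment> \<open>The sign classes of the vertices are carried over to indices along the
        enumeration \<open>vs\<close>.\<close>
      using A sym f V
      by (intro allI signed_symmetric_mat_spectrum[of _ ?n "\<lambda>i. f (vs ! i)"]) (auto simp: entry)
  qed
qed

end
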